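(* Let $(\mathcal X,d)$ be a Polish metric space, let $r\ge 1$, and let $P=\sum_{i=1}^n p_i\,\delta_{x_i}$ and $\tilde P=\sum_{j=1}^{\tilde n}\tilde p_j\,\delta_{\tilde x_j}$ be two discrete probability measures on $\mathcal X$, with $p_i\ge 0$, $\sum_{i=1}^n p_i=1$, $\tilde p_j\ge 0$, $\sum_{j=1}^{\tilde n}\tilde p_j=1$. Let $H(P)=-\sum_{i=1}^n p_i\log p_i$ and $H(\tilde P)=-\sum_{j=1}^{\tilde n}\tilde p_j\log\tilde p_j$. Let $\varepsilon>0$. Then for every $\lambda>0$ satisfying $$\lambda\ge \frac{H(P)+H(\tilde P)}{\varepsilon}$$ it holds that $$s_{r;\lambda}(P,\tilde P)\le w_r(P,\tilde P)\le \tilde s_{r;\lambda}(P,\tilde P)\le s_{r;\lambda}(P,\tilde P)+\varepsilon .$$ Further, the entropies are bounded by $H(P)+H(\tilde P)\le \log n+\log\tilde n$.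
   Context: Let $d_{ij}=d(x_i,\tilde x_j)$. The convention $0\log 0=0$ is used. Let $\Pi$ be the set of matrices $\pi=(\pi_{ij})\in\mathbb R^{n\times\tilde n}$ with $\pi_{ij}\ge 0$ for all $i,j$, $\sum_{j=1}^{\tilde n}\pi_{ij}=p_i$ for $i=1,\dots,n$, and $\sum_{i=1}^n\pi_{ij}=\tilde p_j$ for $j=1,\dots,\tilde n$. The optimal transport cost (the $r$-th power of the Wasserstein distance of order $r$) is $$w_r(P,\tilde P)=\min_{\pi\in\Pi}\ \sum_{i=1}^n\sum_{j=1}^{\tilde n}\pi_{ij}\,d_{ij}^r .$$ For a matrix $\pi\in\Pi$ the entropy is $H(\pi)=-\sum_{i,j}\pi_{ij}\log\pi_{ij}$. For a regularization parameter $\lambda>0$, the entropy-regularized Wasserstein quantity is $$s_{r;\lambda}(P,\tilde P)=\min_{\pi\in\Pi}\ \sum_{i=1}^n\sum_{j=1}^{\tilde n}\pi_{ij}\,d_{ij}^r-\frac1\lambda H(\pi).$$ The minimum is attained at a unique matrix, denoted $\pi^s$, and $$\tilde s_{r;\lambda}(P,\tilde P)=s_{r;\lambda}(P,\tilde P)+\frac1\lambda H(\pi^s)=\sum_{i=1}^n\sum_{j=1}^{\tilde n}\pi^s_{ij}\,d_{ij}^r .$$ *)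

theory Defs
  imports "HOL-Analysis.Analysis"
begin

text \<open>
  A discrete measure \<open>P = (\<Sum>i. p i * delta (x i))\<close> is given by its weight vector \<open>p\<close> and its family of
  atoms \<open>x\<close>, indexed by a finite type whose cardinality is the number of atoms. Atoms may repeat
  and weights may vanish; all quantities below are functions of this representation.
\<close>

definition entropy :: "real ^ 'n \<Rightarrow> real" where
  "entropy p = - (\<Sum>i\<in>UNIV. p $ i * ln (p $ i))"

definition plan_entropy :: "real ^ 'm ^ 'n \<Rightarrow> real" where
  "plan_entropy \<pi> = - (\<Sum>i\<in>UNIV. \<Sum>j\<in>UNIV. \<pi> $ i $ j * ln (\<pi> $ i $ j))"

definition transport_plans :: "real ^ 'n \<Rightarrow> real ^ 'm \<Rightarrow> (real ^ 'm ^ 'n) set" where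
  "transport_plans p q = {\<pi>. (\<forall>i j. 0 \<le> \<pi> $ i $ j) \<and>
     (\<forall>i. (\<Sum>j\<in>UNIV. \<pi> $ i $ j) = p $ i) \<and>
     (\<forall>j. (\<Sum>i\<in>UNIV. \<pi> $ i $ j) = q $ j)}"

definition transport_cost ::
  "real \<Rightarrow> ('n \<Rightarrow> 'x::metric_space) \<Rightarrow> ('m \<Rightarrow> 'x) \<Rightarrow> real ^ 'm ^ 'n \<Rightarrow> real" where
  "transport_cost r x y \<pi> = (\<Sum>i\<in>UNIV. \<Sum>j\<in>UNIV. \<pi> $ i $ j * dist (x i) (y j) powr r)"

definition reg_cost ::
  "real \<Rightarrow> real \<Rightarrow> ('n \<Rightarrow> 'x::metric_space) \<Rightarrow> ('m \<Rightarrow> 'x) \<Rightarrow> real ^ 'm ^ 'n \<Rightarrow> real" where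
  "reg_cost r lam x y \<pi> = transport_cost r x y \<pi> - 1 / lam * plan_entropy \<pi>"

text \<open>
  The minima below are least elements of the sets of attained values, not infima, so that
  using them requires attainment.
\<close>

definition wasserstein_pow ::
  "real \<Rightarrow> real ^ 'n \<Rightarrow> ('n \<Rightarrow> 'x::metric_space) \<Rightarrow> real ^ 'm \<Rightarrow> ('m \<Rightarrow> 'x) \<Rightarrow> real" where
  "wasserstein_pow r p x q y = (LEAST v. v \<in> transport_cost r x y ` transport_plans p q)"

definition reg_wasserstein ::
  "real \<Rightarrow> real \<Rightarrow> real ^ 'n \<Rightarrow> ('n \<Rightarrow> 'x::metric_space) \<Rightarrow> real ^ 'm \<Rightarrow> ('m \<Rightarrow> 'x) \<Rightarrow> real" where
  "reg_wasserstein r lam p x q y = (LEAST v. v \<in> reg_cost r lam x y ` transport_plans p q)"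

definition reg_plan ::
  "real \<Rightarrow> real \<Rightarrow> real ^ 'n \<Rightarrow> ('n \<Rightarrow> 'x::metric_space) \<Rightarrow> real ^ 'm \<Rightarrow> ('m \<Rightarrow> 'x) \<Rightarrow> real ^ 'm ^ 'n" where
  "reg_plan r lam p x q y =
     (THE \<pi>. is_arg_min (reg_cost r lam x y) (\<lambda>\<pi>. \<pi> \<in> transport_plans p q) \<pi>)"

definition reg_wasserstein_tilde ::
  "real \<Rightarrow> real \<Rightarrow> real ^ 'n \<Rightarrow> ('n \<Rightarrow> 'x::metric_space) \<Rightarrow> real ^ 'm \<Rightarrow> ('m \<Rightarrow> 'x) \<Rightarrow> real" where
  "reg_wasserstein_tilde r lam p x q y =
     reg_wasserstein r lam p x q y + 1 / lam * plan_entropy (reg_plan r lam p x q y)"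

end

theory Submission
  imports Defs "HOL-Real_Asymp.Real_Asymp"
begin

text \<open>
  Every plan satisfies \<open>0 \<le> H \<pi> \<le> H P + H Q\<close>: its entries lie in \<open>[0, 1]\<close>, and the upper bound is
  Gibbs' inequality for \<open>\<pi>\<close> against the product coupling. Nonnegativity yields \<open>s \<le> w\<close>, and the
  upper bound makes the difference \<open>H \<pi>\<^sup>s / \<lambda>\<close> of the two regularized costs at most \<open>\<epsilon>\<close>. Minimizers
  exist because the plans form a nonempty compact set, and strict convexity of \<open>t ln t\<close>
  makes the regularized one unique.
\<close>

section \<open>Convexity and continuity of \<open>t * ln t\<close>\<close>

lemma xlnx_tangent_less:
  fixes a m :: real
  assumes "0 \<le> a" "0 < m" "a \<noteq> m"
  shows "a * ln m + a - m < a * ln a"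
proof (cases "a = 0")
  case False
  then have a: "0 < a" using assms by simp
  \<comment> \<open>The left side of the claim is the tangent of \<open>t * ln t\<close> at
    \<open>m\<close>, evaluated at \<open>a\<close>. The bound \<open>ln u \<le> u - 1\<close> at
    \<open>u = m / a\<close>, with equality only at \<open>u = 1\<close>, gives strictness after
    multiplication by \<open>a\<close>.\<close>
  have "ln (m / a) \<noteq> m / a - 1"
    using ln_eq_minus_one[of "m / a"] a assms by auto
  then have "ln (m / a) < m / a - 1"
    using ln_le_minus_one[of "m / a"] a assms by simp
  then have "a * (ln m - ln a) < a * (m / a - 1)"
    using a assms by (simp add: ln_div)
  also have "\<dots> = m - a" using a by (simp add: field_simps)
  finally show ?thesis by (simp add: algebra_simps)
qed (use assms in simp)

lemma xlnx_tangent_le: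
  fixes a m :: real
  assumes "0 \<le> a" "0 \<le> m" "m = 0 \<Longrightarrow> a = 0"
  shows "a * ln m + a - m \<le> a * ln a"
  using xlnx_tangent_less[of a m] assms by (cases "a = m"; cases "m = 0") auto

text \<open>Add the tangent inequalities at the midpoint \<open>m\<close> for \<open>a\<close> and
  for \<open>b\<close>: since \<open>a + b = 2 * m\<close>, the linear terms cancel.\<close>

lemma xlnx_midpoint_less:
  fixes a b :: real
  assumes "0 \<le> a" "0 \<le> b" "a \<noteq> b"
  shows "2 * ((a + b) / 2 * ln ((a + b) / 2)) < a * ln a + b * ln b"
proof -
  define m where "m = (a + b) / 2"
  have "0 < m" "a \<noteq> m" "b \<noteq> m" using assms by (auto simp: m_def)
  then have "a * ln m + a - m < a * ln a" "b * ln m + b - m < b * ln b"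
    using assms by (auto intro: xlnx_tangent_less)
  moreover have b: "b = 2 * m - a" by (simp add: m_def field_simps)
  have "(a * ln m + a - m) + (b * ln m + b - m) = 2 * (m * ln m)"
    by (simp add: b algebra_simps)
  ultimately show ?thesis unfolding m_def[symmetric] by linarith
qed

lemma xlnx_midpoint_le:
  fixes a b :: real
  assumes "0 \<le> a" "0 \<le> b"
  shows "2 * ((a + b) / 2 * ln ((a + b) / 2)) \<le> a * ln a + b * ln b"
  using xlnx_midpoint_less[OF assms] by (cases "a = b") auto

text \<open>Sum the tangent inequalities at the points \<open>g i\<close>; the linear terms
  \<open>f i - g i\<close> add up to 0 because the total masses agree.\<close>

lemma gibbs_inequality:
  fixes f g :: "'a \<Rightarrow> real"
  assumes "\<And>i. i \<in> A \<Longrightarrow> 0 \<le> f i" "\<And>i. i \<in> A \<Longrightarrow> 0 \<le> g i"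
    and "\<And>i. i \<in> A \<Longrightarrow> g i = 0 \<Longrightarrow> f i = 0" and "sum f A = sum g A"
  shows "(\<Sum>i\<in>A. f i * ln (g i)) \<le> (\<Sum>i\<in>A. f i * ln (f i))"
proof -
  have "(\<Sum>i\<in>A. f i * ln (g i) + f i - g i) \<le> (\<Sum>i\<in>A. f i * ln (f i))"
    using assms by (intro sum_mono xlnx_tangent_le) auto
  then show ?thesis
    using assms(4) by (simp add: sum.distrib sum_subtractf)
qed

lemma continuous_on_xlnx: "continuous_on {0..} (\<lambda>t::real. t * ln t)"
  unfolding continuous_on_def
proof
  fix t :: real assume t: "t \<in> {0..}"
  show "((\<lambda>t. t * ln t) \<longlongrightarrow> t * ln t) (at t within {0..})"
  proof (cases "t = 0")
    case True
    \<comment> \<open>The one-sided limit matches the convention \<open>0 * ln 0 = 0\<close>, which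
      here comes from the factor 0.\<close>
    have "((\<lambda>t::real. t * ln t) \<longlongrightarrow> 0) (at_right 0)" by real_asymp
    moreover have "at (0::real) within {0..} = at_right 0"
      by (intro at_within_nhd[where S = UNIV]) auto
    ultimately show ?thesis using True by simp
  next
    case False
    then show ?thesis by (auto intro!: tendsto_intros)
  qed
qed

section \<open>Entropy bounds for marginals and plans\<close>

lemma entropy_le_ln_card:
  fixes p :: "real ^ 'n::finite"
  assumes "\<And>i. 0 \<le> p $ i" "(\<Sum>i\<in>UNIV. p $ i) = 1"
  shows "entropy p \<le> ln (real CARD('n))"
proof -
  \<comment> \<open>Gibbs' inequality against the uniform distribution.\<close>
  have "(\<Sum>i\<in>UNIV. p $ i * ln (1 / real CARD('n))) \<le> (\<Sum>i\<in>UNIV. p $ i * ln (p $ i))"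
    using assms by (intro gibbs_inequality) auto
  also have "(\<Sum>i\<in>UNIV. p $ i * ln (1 / real CARD('n))) = - ln (real CARD('n))"
    using assms(2) by (simp add: sum_distrib_right[symmetric] sum_negf ln_div)
  finally show ?thesis by (simp add: entropy_def)
qed

context
  fixes p :: "real ^ 'n::finite" and q :: "real ^ 'm::finite" and \<pi> :: "real ^ 'm ^ 'n"
  assumes plan: "\<pi> \<in> transport_plans p q"
begin

lemma transport_plan_nonneg: "0 \<le> \<pi> $ i $ j"
  using plan by (simp add: transport_plans_def)

lemma transport_plan_row_sum: "(\<Sum>j\<in>UNIV. \<pi> $ i $ j) = p $ i"
  using plan by (simp add: transport_plans_def)

lemma transport_plan_col_sum: "(\<Sum>i\<in>UNIV. \<pi> $ i $ j) = q $ j"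
  using plan by (simp add: transport_plans_def)

lemma transport_plan_le_row: "\<pi> $ i $ j \<le> p $ i"
  unfolding transport_plan_row_sum[symmetric]
  by (rule member_le_sum) (auto intro: transport_plan_nonneg)

lemma transport_plan_le_col: "\<pi> $ i $ j \<le> q $ j"
  unfolding transport_plan_col_sum[symmetric]
  by (rule member_le_sum[of i UNIV "\<lambda>i. \<pi> $ i $ j"]) (auto intro: transport_plan_nonneg)

lemma plan_entropy_nonneg:
  assumes "(\<Sum>i\<in>UNIV. p $ i) = 1"
  shows "0 \<le> plan_entropy \<pi>"
proof -
  have "\<pi> $ i $ j * ln (\<pi> $ i $ j) \<le> 0" for i j
  proof -
    have "p $ k \<ge> 0" for k
      using transport_plan_nonneg transport_plan_le_row order_trans by blast
    then have "p $ i \<le> (\<Sum>i\<in>UNIV. p $ i)" by (intro member_le_sum) auto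
    then have "\<pi> $ i $ j \<le> 1" using transport_plan_le_row[of i j] assms by linarith
    then show ?thesis
      using transport_plan_nonneg[of i j]
      by (cases "\<pi> $ i $ j = 0") (auto intro!: mult_nonneg_nonpos)
  qed
  then show ?thesis by (simp add: plan_entropy_def sum_nonpos)
qed

lemma plan_entropy_le:
  assumes p1: "(\<Sum>i\<in>UNIV. p $ i) = 1" and q1: "(\<Sum>j\<in>UNIV. q $ j) = 1"
  shows "plan_entropy \<pi> \<le> entropy p + entropy q"
proof -
  have pos: "0 \<le> p $ i" "0 \<le> q $ j" for i j
    using transport_plan_nonneg transport_plan_le_row transport_plan_le_col order_trans by blast+
  let ?f = "\<lambda>(i, j). \<pi> $ i $ j" and ?g = "\<lambda>(i, j). p $ i * q $ j"
  \<comment> \<open>The plan is absolutely continuous with respect to the product coupling. This is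
    needed for Gibbs' inequality and again below, to split the logarithm of the product where a
    weight vanishes.\<close>
  have zero: "\<pi> $ i $ j = 0" if "p $ i = 0 \<or> q $ j = 0" for i j
    using that transport_plan_nonneg[of i j] transport_plan_le_row[of i j]
      transport_plan_le_col[of i j] by auto
  have "(\<Sum>z\<in>UNIV \<times> UNIV. ?f z * ln (?g z)) \<le> (\<Sum>z\<in>UNIV \<times> UNIV. ?f z * ln (?f z))"
  proof (rule gibbs_inequality)
    show "sum ?f (UNIV \<times> UNIV) = sum ?g (UNIV \<times> UNIV)"
      unfolding sum.cartesian_product[symmetric]
      by (simp add: transport_plan_row_sum p1 q1 sum_distrib_left[symmetric])
  qed (use pos zero transport_plan_nonneg in auto)
  moreover have "(\<Sum>z\<in>UNIV \<times> UNIV. ?f z * ln (?f z)) = - plan_entropy \<pi>"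
    by (simp add: plan_entropy_def sum.cartesian_product split_def)
  moreover have "(\<Sum>z\<in>UNIV \<times> UNIV. ?f z * ln (?g z)) = - entropy p - entropy q"
  proof -
    \<comment> \<open>After the split, each logarithm depends on one index only; summing over the
      other index replaces the plan by its marginal.\<close>
    have "\<pi> $ i $ j * ln (p $ i * q $ j) = \<pi> $ i $ j * ln (p $ i) + \<pi> $ i $ j * ln (q $ j)" for i j
      using zero[of i j] pos(1)[of i] pos(2)[of j]
      by (cases "p $ i = 0 \<or> q $ j = 0") (auto simp: ln_mult algebra_simps)
    then have "(\<Sum>z\<in>UNIV \<times> UNIV. ?f z * ln (?g z)) =
        (\<Sum>i\<in>UNIV. \<Sum>j\<in>UNIV. \<pi> $ i $ j * ln (p $ i)) + (\<Sum>i\<in>UNIV. \<Sum>j\<in>UNIV. \<pi> $ i $ j * ln (q $ j))"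
      by (simp add: split_def sum.cartesian_product sum.distrib)
    also have "(\<Sum>i\<in>UNIV. \<Sum>j\<in>UNIV. \<pi> $ i $ j * ln (p $ i)) = - entropy p"
      by (simp add: entropy_def sum_distrib_right[symmetric] transport_plan_row_sum)
    also have "(\<Sum>i\<in>UNIV. \<Sum>j\<in>UNIV. \<pi> $ i $ j * ln (q $ j)) = - entropy q"
      by (subst sum.swap)
        (simp add: entropy_def sum_distrib_right[symmetric] transport_plan_col_sum)
    finally show ?thesis by simp
  qed
  ultimately show ?thesis by linarith
qed

end

section \<open>The set of transport plans\<close>

lemma transport_plans_nonempty:
  fixes p :: "real ^ 'n::finite" and q :: "real ^ 'm::finite"
  assumes "\<And>i. 0 \<le> p $ i" "(\<Sum>i\<in>UNIV. p $ i) = 1" "\<And>j. 0 \<le> q $ j" "(\<Sum>j\<in>UNIV. q $ j) = 1"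
  shows "transport_plans p q \<noteq> {}"
proof -
  have "(\<chi> i j. p $ i * q $ j) \<in> transport_plans p q"
    using assms
    by (simp add: transport_plans_def sum_distrib_left[symmetric] sum_distrib_right[symmetric])
  then show ?thesis by blast
qed

lemma compact_transport_plans:
  fixes p :: "real ^ 'n::finite" and q :: "real ^ 'm::finite"
  shows "compact (transport_plans p q)"
  unfolding compact_eq_bounded_closed
proof
  have "norm \<pi> \<le> (\<Sum>i\<in>UNIV. p $ i)" if \<pi>: "\<pi> \<in> transport_plans p q" for \<pi>
  proof -
    \<comment> \<open>The Euclidean norm is bounded by the sum of absolute entries, which for a plan
      is its total mass.\<close>
    have "norm \<pi> \<le> (\<Sum>i\<in>UNIV. norm (\<pi> $ i))"
      unfolding norm_vec_def[of \<pi>] by (rule L2_set_le_sum) simp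
    also have "\<dots> \<le> (\<Sum>i\<in>UNIV. \<Sum>j\<in>UNIV. \<bar>\<pi> $ i $ j\<bar>)"
      by (intro sum_mono norm_le_l1_cart)
    also have "\<dots> = (\<Sum>i\<in>UNIV. p $ i)"
      using transport_plan_nonneg[OF \<pi>] transport_plan_row_sum[OF \<pi>] by simp
    finally show ?thesis .
  qed
  then show "bounded (transport_plans p q)" by (auto simp: bounded_iff)
  show "closed (transport_plans p q)"
    unfolding transport_plans_def
    by (intro closed_Collect_conj closed_Collect_all closed_Collect_le closed_Collect_eq
        continuous_intros)
qed

lemma midpoint_transport_plan:
  assumes "\<pi> \<in> transport_plans p q" "\<rho> \<in> transport_plans p q"
  shows "(1 / 2) *\<^sub>R (\<pi> + \<rho>) \<in> transport_plans p q"
  using assms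
  by (simp add: transport_plans_def sum.distrib add_divide_distrib sum_divide_distrib[symmetric])

section \<open>Continuity and strict midpoint convexity of the costs\<close>

lemma continuous_on_transport_cost: "continuous_on S (transport_cost r x y)"
  unfolding transport_cost_def by (intro continuous_intros)

text \<open>Plans have nonnegative entries, so continuity of \<open>t * ln t\<close> on
  \<open>{0..}\<close> applies entrywise.\<close>

lemma continuous_on_plan_entropy:
  "continuous_on (transport_plans p q) plan_entropy"
  unfolding plan_entropy_def
  by (intro continuous_intros continuous_on_compose2[OF continuous_on_xlnx])
    (auto intro: transport_plan_nonneg)

lemma continuous_on_reg_cost: "continuous_on (transport_plans p q) (reg_cost r lam x y)"
  unfolding reg_cost_def
  by (intro continuous_intros continuous_on_transport_cost continuous_on_plan_entropy)

lemma transport_cost_midpoint: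
  "2 * transport_cost r x y ((1 / 2) *\<^sub>R (\<pi> + \<rho>)) = transport_cost r x y \<pi> + transport_cost r x y \<rho>"
  by (simp add: transport_cost_def sum_distrib_left sum.distrib[symmetric] algebra_simps)

lemma plan_entropy_midpoint_less:
  fixes \<pi> \<rho> :: "real ^ 'm::finite ^ 'n::finite"
  assumes \<pi>: "\<pi> \<in> transport_plans p q" and \<rho>: "\<rho> \<in> transport_plans p q" and "\<pi> \<noteq> \<rho>"
  shows "plan_entropy \<pi> + plan_entropy \<rho> < 2 * plan_entropy ((1 / 2) *\<^sub>R (\<pi> + \<rho>))"
proof -
  let ?\<phi> = "\<lambda>t::real. t * ln t"
  let ?l = "\<lambda>i j. 2 * ?\<phi> ((\<pi> $ i $ j + \<rho> $ i $ j) / 2)"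
  let ?r = "\<lambda>i j. ?\<phi> (\<pi> $ i $ j) + ?\<phi> (\<rho> $ i $ j)"
  note nonneg = transport_plan_nonneg[OF \<pi>] transport_plan_nonneg[OF \<rho>]
  obtain a b where ab: "\<pi> $ a $ b \<noteq> \<rho> $ a $ b" using \<open>\<pi> \<noteq> \<rho>\<close> by (auto simp: vec_eq_iff)
  have le: "?l i j \<le> ?r i j" for i j by (intro xlnx_midpoint_le nonneg)
  have less: "?l a b < ?r a b" by (intro xlnx_midpoint_less nonneg ab)
  \<comment> \<open>A single entry where the plans differ suffices: strictness passes from entry
    \<open>(a, b)\<close> to row \<open>a\<close>, then to the double sum.\<close>
  have "(\<Sum>i\<in>UNIV. \<Sum>j\<in>UNIV. ?l i j) < (\<Sum>i\<in>UNIV. \<Sum>j\<in>UNIV. ?r i j)"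
  proof (rule sum_strict_mono_ex1)
    have "(\<Sum>j\<in>UNIV. ?l a j) < (\<Sum>j\<in>UNIV. ?r a j)"
      by (rule sum_strict_mono_ex1) (use le less in auto)
    then show "\<exists>i\<in>UNIV. (\<Sum>j\<in>UNIV. ?l i j) < (\<Sum>j\<in>UNIV. ?r i j)" by blast
  qed (intro finite ballI sum_mono le)+
  then show ?thesis
    by (simp add: plan_entropy_def sum.distrib sum_distrib_left)
qed

text \<open>The transport cost is linear in the plan, so the strict gap comes entirely from the
  entropy, scaled by the positive factor \<open>1 / lam\<close>.\<close>

lemma reg_cost_midpoint_less:
  fixes \<pi> \<rho> :: "real ^ 'm::finite ^ 'n::finite"
  assumes "\<pi> \<in> transport_plans p q" "\<rho> \<in> transport_plans p q" "\<pi> \<noteq> \<rho>" "0 < lam"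
  shows "2 * reg_cost r lam x y ((1 / 2) *\<^sub>R (\<pi> + \<rho>)) < reg_cost r lam x y \<pi> + reg_cost r lam x y \<rho>"
proof -
  have "1 / lam * (plan_entropy \<pi> + plan_entropy \<rho>) <
      1 / lam * (2 * plan_entropy ((1 / 2) *\<^sub>R (\<pi> + \<rho>)))"
    using plan_entropy_midpoint_less[OF assms(1-3)] assms(4) by (intro mult_strict_left_mono) auto
  then show ?thesis
    using transport_cost_midpoint[of r x y \<pi> \<rho>]
    by (simp add: reg_cost_def algebra_simps)
qed

section \<open>Existence and uniqueness of minimizers\<close>

lemma Least_image_eq_arg_min:
  fixes f :: "'a \<Rightarrow> 'b::linorder"
  assumes "is_arg_min f (\<lambda>a. a \<in> S) a"
  shows "(LEAST v. v \<in> f ` S) = f a"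
  using assms by (intro Least_equality) (auto simp: is_arg_min_linorder)

lemma compact_arg_min_exists:
  fixes f :: "'a::topological_space \<Rightarrow> real"
  assumes "compact S" "S \<noteq> {}" "continuous_on S f"
  obtains a where "is_arg_min f (\<lambda>a. a \<in> S) a"
  using continuous_attains_inf[OF assms] by (auto simp: is_arg_min_linorder)

text \<open>Justifies the definite description in \<open>reg_plan\<close>: compactness gives a
  minimizer, strict midpoint convexity excludes a second one.\<close>

lemma is_arg_min_reg_plan:
  fixes p :: "real ^ 'n::finite" and q :: "real ^ 'm::finite"
  assumes "transport_plans p q \<noteq> {}" "0 < lam"
  shows "is_arg_min (reg_cost r lam x y) (\<lambda>\<pi>. \<pi> \<in> transport_plans p q) (reg_plan r lam p x q y)"
proof -
  obtain \<pi> where \<pi>: "is_arg_min (reg_cost r lam x y) (\<lambda>\<pi>. \<pi> \<in> transport_plans p q) \<pi>"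
    using compact_arg_min_exists[OF compact_transport_plans assms(1) continuous_on_reg_cost] .
  have "\<rho> = \<pi>" if \<rho>: "is_arg_min (reg_cost r lam x y) (\<lambda>\<pi>. \<pi> \<in> transport_plans p q) \<rho>" for \<rho>
  proof (rule ccontr)
    assume "\<rho> \<noteq> \<pi>"
    have mem: "\<rho> \<in> transport_plans p q" "\<pi> \<in> transport_plans p q"
      using \<rho> \<pi> by (auto simp: is_arg_min_linorder)
    let ?m = "(1 / 2) *\<^sub>R (\<rho> + \<pi>)"
    \<comment> \<open>The midpoint is itself a plan, so neither minimizer costs more than it; yet
      its cost lies strictly below their average.\<close>
    have "reg_cost r lam x y \<rho> \<le> reg_cost r lam x y ?m" "reg_cost r lam x y \<pi> \<le> reg_cost r lam x y ?m"
      using \<rho> \<pi> midpoint_transport_plan[OF mem] by (auto simp: is_arg_min_linorder)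
    then show False
      using reg_cost_midpoint_less[OF mem \<open>\<rho> \<noteq> \<pi>\<close> assms(2), of r x y] by linarith
  qed
  then show ?thesis unfolding reg_plan_def using \<pi> by (rule theI[rotated])
qed

section \<open>Comparison of the regularized and unregularized problems\<close>

theorem lemma3p3:
  fixes x :: "'n::finite \<Rightarrow> 'x::polish_space"
    and y :: "'m::finite \<Rightarrow> 'x"
    and p :: "real ^ 'n"
    and q :: "real ^ 'm"
    and r \<epsilon> :: real
  assumes "r \<ge> 1"
    and "\<And>i. p $ i \<ge> 0" and "(\<Sum>i\<in>UNIV. p $ i) = 1"
    and "\<And>j. q $ j \<ge> 0" and "(\<Sum>j\<in>UNIV. q $ j) = 1"
    and "\<epsilon> > 0"
  shows "(\<forall>lam>0. lam \<ge> (entropy p + entropy q) / \<epsilon> \<longrightarrow>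
            reg_wasserstein r lam p x q y \<le> wasserstein_pow r p x q y \<and>
            wasserstein_pow r p x q y \<le> reg_wasserstein_tilde r lam p x q y \<and>
            reg_wasserstein_tilde r lam p x q y \<le> reg_wasserstein r lam p x q y + \<epsilon>) \<and>
         entropy p + entropy q \<le> ln (real CARD('n)) + ln (real CARD('m))"
proof -
  have ne: "transport_plans p q \<noteq> {}" using assms by (intro transport_plans_nonempty)
  obtain \<omega> where \<omega>: "is_arg_min (transport_cost r x y) (\<lambda>\<pi>. \<pi> \<in> transport_plans p q) \<omega>"
    using compact_arg_min_exists[OF compact_transport_plans ne continuous_on_transport_cost] .
  then have \<omega>_plan: "\<omega> \<in> transport_plans p q"
    and \<omega>_min: "\<And>\<pi>. \<pi> \<in> transport_plans p q \<Longrightarrow> transport_cost r x y \<omega> \<le> transport_cost r x y \<pi>"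
    by (auto simp: is_arg_min_linorder)
  have w: "wasserstein_pow r p x q y = transport_cost r x y \<omega>"
    unfolding wasserstein_pow_def using \<omega> by (rule Least_image_eq_arg_min)
  have "reg_wasserstein r lam p x q y \<le> wasserstein_pow r p x q y \<and>
      wasserstein_pow r p x q y \<le> reg_wasserstein_tilde r lam p x q y \<and>
      reg_wasserstein_tilde r lam p x q y \<le> reg_wasserstein r lam p x q y + \<epsilon>"
    if lam: "0 < lam" "(entropy p + entropy q) / \<epsilon> \<le> lam" for lam
  proof -
    define \<sigma> where "\<sigma> = reg_plan r lam p x q y"
    have \<sigma>: "is_arg_min (reg_cost r lam x y) (\<lambda>\<pi>. \<pi> \<in> transport_plans p q) \<sigma>"
      unfolding \<sigma>_def using ne lam(1) by (rule is_arg_min_reg_plan)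
    then have \<sigma>_plan: "\<sigma> \<in> transport_plans p q"
      and \<sigma>_min: "reg_cost r lam x y \<sigma> \<le> reg_cost r lam x y \<omega>"
      using \<omega>_plan by (auto simp: is_arg_min_linorder)
    have s: "reg_wasserstein r lam p x q y = reg_cost r lam x y \<sigma>"
      unfolding reg_wasserstein_def using \<sigma> by (rule Least_image_eq_arg_min)
    have tilde: "reg_wasserstein_tilde r lam p x q y = transport_cost r x y \<sigma>"
      unfolding reg_wasserstein_tilde_def s \<sigma>_def[symmetric] by (simp add: reg_cost_def)
    have "reg_cost r lam x y \<omega> \<le> transport_cost r x y \<omega>"
      using plan_entropy_nonneg[OF \<omega>_plan] assms(3) lam(1) by (simp add: reg_cost_def)
    moreover have "1 / lam * plan_entropy \<sigma> \<le> \<epsilon>"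
    proof -
      have "plan_entropy \<sigma> \<le> entropy p + entropy q"
        using \<sigma>_plan assms(3,5) by (rule plan_entropy_le)
      \<comment> \<open>The lower bound on \<open>lam\<close> enters here.\<close>
      also have "\<dots> \<le> lam * \<epsilon>" using lam(2) \<open>\<epsilon> > 0\<close> by (simp add: pos_divide_le_eq)
      finally show ?thesis using lam(1) by (simp add: field_simps)
    qed
    \<comment> \<open>Testing the regularized problem with \<omega> gives the first inequality,
      testing the unregularized one with \<sigma> gives the second, and the third is the bound on
      \<open>1 / lam * plan_entropy \<sigma>\<close>.\<close>
    ultimately show ?thesis
      using \<sigma>_min \<omega>_min[OF \<sigma>_plan] unfolding w s tilde by (simp add: reg_cost_def)
  qed
  moreover have "entropy p + entropy q \<le> ln (real CARD('n)) + ln (real CARD('m))"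
    using assms by (intro add_mono entropy_le_ln_card)
  ultimately show ?thesis by blast
qed

end
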